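(* Let $u\colon\mathbb{R}^3\to\mathbb{O}$ have octonion Fourier transform $U$. Let $f_0\in\mathbb{R}$ and, for $i=1,2,3$, let $u^{\cos,i}(\mathbf{x})=u(\mathbf{x})\cdot\cos(2\pi f_0x_i)$ and let $U^{\cos,i}$ be the octonion Fourier transform of $u^{\cos,i}$. Then for all $(f_1,f_2,f_3)\in\mathbb{R}^3$ $$\begin{aligned} U^{\cos,1}(f_1,f_2,f_3)&=\big(U(f_1+f_0,f_2,f_3)+U(f_1-f_0,f_2,f_3)\big)\cdot\tfrac12, \\ U^{\cos,2}(f_1,f_2,f_3)&=\big(U(f_1,f_2+f_0,f_3)+U(f_1,f_2-f_0,f_3)\big)\cdot\tfrac12, \\ U^{\cos,3}(f_1,f_2,f_3)&=\big(U(f_1,f_2,f_3+f_0)+U(f_1,f_2,f_3-f_0)\big)\cdot\tfrac12.\end{aligned}$$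
   Context: $\mathbb{O}$ denotes the real algebra of octonions with basis $1,\mathbf{e}_1,\dots,\mathbf{e}_7$: an octonion is a pair $(q_0,q_1)$ of quaternions (quaternion units $\mathbf{e}_1,\mathbf{e}_2,\mathbf{e}_3$ with $\mathbf{e}_1\mathbf{e}_2=\mathbf{e}_3$), with product $(q_0,q_1)\cdot(p_0,p_1)=(q_0p_0-p_1^*q_1,\;p_1q_0+q_1p_0^* )$, where $^*$ is quaternion conjugation, and $\mathbf{e}_4=(0,1)$, $\mathbf{e}_5=(0,\mathbf{e}_1)$, $\mathbf{e}_6=(0,\mathbf{e}_2)$, $\mathbf{e}_7=(0,\mathbf{e}_3)$. The product is neither commutative nor associative; products without brackets are evaluated from left to right, i.e. $abcd=((ab)c)d$. For an imaginary unit $\mathbf{e}_k$ and $\alpha\in\mathbb{R}$, $e^{\mathbf{e}_k\alpha}=\cos\alpha+\mathbf{e}_k\sin\alpha$. Integrals of octonion-valued functions are taken componentwise. The octonion Fourier transform (OFT) of a Lebesgue integrable $u\colon\mathbb{R}^3\to\mathbb{O}$ is $$U(\mathbf{f})=\int_{\mathbb{R}^3}u(\mathbf{x})\,e^{-\mathbf{e}_1 2\pi f_1x_1}\,e^{-\mathbf{e}_2 2\pi f_2x_2}\,e^{-\mathbf{e}_4 2\pi f_3x_3}\,d\mathbf{x},\qquad \mathbf{f}=(f_1,f_2,f_3)\in\mathbb{R}^3,$$ with multiplication from left to right. Standing assumption: $u$ is Lebesgue integrable, so that its OFT is well defined. *)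

theory Defs
  imports "HOL-Analysis.Analysis"
begin

text \<open>
  \<^term>\<open>(a, b, c, d)\<close> stands for the quaternion \<open>a + b e1 + c e2 + d e3\<close>. Both types are products
  of copies of \<^typ>\<open>real\<close>, so the real vector space structure (0, \<open>+\<close>, \<open>-\<close>, \<open>*\<^sub>R\<close>), the Euclidean
  norm and the Bochner integral are the library's. The octonion product is not associative, so
  no multiplicative type class beyond \<^class>\<open>times\<close> would apply to it; it is a plain function
  with its own infix symbol.
\<close>

type_synonym quat = "real \<times> real \<times> real \<times> real"
type_synonym octonion = "quat \<times> quat"

fun quat_mult :: "quat \<Rightarrow> quat \<Rightarrow> quat"  (infixl "\<bullet>\<^sub>q" 70) where
  "(a0, a1, a2, a3) \<bullet>\<^sub>q (b0, b1, b2, b3) =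
    (a0 * b0 - a1 * b1 - a2 * b2 - a3 * b3,
     a0 * b1 + a1 * b0 + a2 * b3 - a3 * b2,
     a0 * b2 - a1 * b3 + a2 * b0 + a3 * b1,
     a0 * b3 + a1 * b2 - a2 * b1 + a3 * b0)"

fun quat_cnj :: "quat \<Rightarrow> quat" where
  "quat_cnj (a0, a1, a2, a3) = (a0, - a1, - a2, - a3)"

text \<open>\<open>infixl\<close> gives the left-to-right reading of unbracketed products.\<close>

fun oct_mult :: "octonion \<Rightarrow> octonion \<Rightarrow> octonion"  (infixl "\<bullet>\<^sub>o" 70) where
  "(q0, q1) \<bullet>\<^sub>o (p0, p1) =
    (q0 \<bullet>\<^sub>q p0 - quat_cnj p1 \<bullet>\<^sub>q q1, p1 \<bullet>\<^sub>q q0 + q1 \<bullet>\<^sub>q quat_cnj p0)"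

definition oct_one :: octonion where "oct_one = ((1, 0, 0, 0), 0)"
definition oct_e1 :: octonion where "oct_e1 = ((0, 1, 0, 0), 0)"
definition oct_e2 :: octonion where "oct_e2 = ((0, 0, 1, 0), 0)"
definition oct_e4 :: octonion where "oct_e4 = (0, (1, 0, 0, 0))"

text \<open>Multiplying by a real number, embedded in the octonions, is scalar multiplication.\<close>

lemma oct_mult_of_real: "u \<bullet>\<^sub>o (c *\<^sub>R oct_one) = c *\<^sub>R u"
  by (cases u) (auto simp: oct_one_def zero_prod_def)

text \<open>\<open>oct_exp e \<alpha>\<close> is the exponential of \<open>e \<alpha>\<close>; meant only for an imaginary unit \<open>e\<close>.\<close>

definition oct_exp :: "octonion \<Rightarrow> real \<Rightarrow> octonion" where
  "oct_exp e \<alpha> = cos \<alpha> *\<^sub>R oct_one + sin \<alpha> *\<^sub>R e"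

definition OFT :: "(real^3 \<Rightarrow> octonion) \<Rightarrow> real^3 \<Rightarrow> octonion" where
  "OFT u f = (\<integral>x. u x \<bullet>\<^sub>o oct_exp oct_e1 (- (2 * pi * f$1 * x$1))
                    \<bullet>\<^sub>o oct_exp oct_e2 (- (2 * pi * f$2 * x$2))
                    \<bullet>\<^sub>o oct_exp oct_e4 (- (2 * pi * f$3 * x$3)) \<partial>lebesgue)"

text \<open>The integral of an integrable octonion-valued function is the componentwise one.\<close>

lemma integral_prod_componentwise:
  fixes g :: "'c \<Rightarrow> 'a::{banach, second_countable_topology} \<times> 'b::{banach, second_countable_topology}"
  assumes "integrable M g"
  shows "integral\<^sup>L M g = (\<integral>x. fst (g x) \<partial>M, \<integral>x. snd (g x) \<partial>M)"
  using integral_bounded_linear[OF bounded_linear_fst assms]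
    integral_bounded_linear[OF bounded_linear_snd assms]
  by (simp add: prod_eq_iff)

lemma integral_octonion_componentwise:
  fixes g :: "'c \<Rightarrow> octonion"
  assumes g: "integrable M g"
  shows "integral\<^sup>L M g =
    ((\<integral>x. fst (fst (g x)) \<partial>M, \<integral>x. fst (snd (fst (g x))) \<partial>M,
      \<integral>x. fst (snd (snd (fst (g x)))) \<partial>M, \<integral>x. snd (snd (snd (fst (g x)))) \<partial>M),
     (\<integral>x. fst (snd (g x)) \<partial>M, \<integral>x. fst (snd (snd (g x))) \<partial>M,
      \<integral>x. fst (snd (snd (snd (g x)))) \<partial>M, \<integral>x. snd (snd (snd (snd (g x)))) \<partial>M))"
proof -
  note c = integral_prod_componentwise
  note f = integrable_bounded_linear[OF bounded_linear_fst]
  note s = integrable_bounded_linear[OF bounded_linear_snd]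
  show ?thesis
    unfolding c[OF g] c[OF f[OF g]] c[OF s[OF g]] c[OF s[OF f[OF g]]] c[OF s[OF s[OF g]]]
      c[OF s[OF s[OF f[OF g]]]] c[OF s[OF s[OF s[OF g]]]] ..
qed

end

theory Submission
  imports Defs
begin

text \<open>
  The cosine factor is a real number at every point. The octonion product is real-bilinear, so this
  factor may be moved from \<open>u x\<close> onto any one of the three exponentials, although the product is
  neither commutative nor associative; the exponential to choose is the one that contains the same
  coordinate as the cosine. There the product-to-sum formulas
  turn \<open>cos \<beta>\<close> times \<open>oct_exp e \<alpha>\<close> into the mean of \<open>oct_exp e (\<alpha> + \<beta>)\<close> and \<open>oct_exp e (\<alpha> - \<beta>)\<close>
  (\<open>oct_exp_modulation\<close>), which are the exponentials for the two shifted frequencies. The integrand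
  of the modulated transform is therefore, at every point, the mean of two integrands of the original
  transform.

  It remains to integrate this identity, and splitting the integral of a sum needs the two integrands
  to be integrable (\<open>integrable_OFT_integrand\<close>): each exponential is a combination of fixed octonions
  whose real coefficients are bounded and measurable, so multiplying by it preserves integrability.
\<close>

lemma bounded_bilinear_oct_mult: "bounded_bilinear (\<bullet>\<^sub>o)"
proof -
  have "bilinear (\<bullet>\<^sub>o)"
    unfolding bilinear_def
  proof (intro allI conjI linearI)
    fix u v w :: octonion and c :: real
    obtain a0 a1 a2 a3 b0 b1 b2 b3 where u: "u = ((a0, a1, a2, a3), (b0, b1, b2, b3))"
      by (metis surj_pair)
    obtain c0 c1 c2 c3 d0 d1 d2 d3 where v: "v = ((c0, c1, c2, c3), (d0, d1, d2, d3))"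
      by (metis surj_pair)
    obtain p0 p1 p2 p3 q0 q1 q2 q3 where w: "w = ((p0, p1, p2, p3), (q0, q1, q2, q3))"
      by (metis surj_pair)
    show "u \<bullet>\<^sub>o (v + w) = u \<bullet>\<^sub>o v + u \<bullet>\<^sub>o w"
      unfolding u v w by (simp add: algebra_simps)
    show "(v + w) \<bullet>\<^sub>o u = v \<bullet>\<^sub>o u + w \<bullet>\<^sub>o u"
      unfolding u v w by (simp add: algebra_simps)
    show "u \<bullet>\<^sub>o (c *\<^sub>R v) = c *\<^sub>R (u \<bullet>\<^sub>o v)"
      unfolding u v by (simp add: algebra_simps)
    show "(c *\<^sub>R v) \<bullet>\<^sub>o u = c *\<^sub>R (v \<bullet>\<^sub>o u)"
      unfolding u v by (simp add: algebra_simps)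
  qed
  then show ?thesis
    by (simp add: bilinear_conv_bounded_bilinear)
qed

interpretation oct: bounded_bilinear "(\<bullet>\<^sub>o)"
  by (rule bounded_bilinear_oct_mult)

lemma oct_mult_oct_exp: "p \<bullet>\<^sub>o oct_exp e \<alpha> = cos \<alpha> *\<^sub>R p + sin \<alpha> *\<^sub>R (p \<bullet>\<^sub>o e)"
  by (simp add: oct_exp_def oct.add_right oct.scaleR_right[of p _ e] oct_mult_of_real)

lemma oct_exp_modulation:
  "cos \<beta> *\<^sub>R oct_exp e \<alpha> = (1/2) *\<^sub>R (oct_exp e (\<alpha> + \<beta>) + oct_exp e (\<alpha> - \<beta>))"
proof -
  have "oct_exp e (\<alpha> + \<beta>) + oct_exp e (\<alpha> - \<beta>)
      = (cos (\<alpha> + \<beta>) + cos (\<alpha> - \<beta>)) *\<^sub>R oct_one + (sin (\<alpha> + \<beta>) + sin (\<alpha> - \<beta>)) *\<^sub>R e"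
    by (simp add: oct_exp_def scaleR_left_distrib)
  also have "\<dots> = (2 * cos \<beta> * cos \<alpha>) *\<^sub>R oct_one + (2 * cos \<beta> * sin \<alpha>) *\<^sub>R e"
    by (simp add: cos_add cos_diff sin_add sin_diff mult_ac)
  finally show ?thesis
    by (simp add: oct_exp_def scaleR_right_distrib)
qed

lemma integrable_oct_mult_oct_exp:
  assumes g: "integrable M g" and \<alpha>: "\<alpha> \<in> borel_measurable M"
  shows "integrable M (\<lambda>x. g x \<bullet>\<^sub>o oct_exp e (\<alpha> x))"
proof -
  have bounded_scaleR: "integrable M (\<lambda>x. \<phi> x *\<^sub>R h x)"
    if "integrable M h" "\<phi> \<in> borel_measurable M" "\<And>x. \<bar>\<phi> x\<bar> \<le> 1"
    for \<phi> :: "_ \<Rightarrow> real" and h :: "_ \<Rightarrow> octonion"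
  proof (rule Bochner_Integration.integrable_bound)
    show "integrable M h" by fact
    show "(\<lambda>x. \<phi> x *\<^sub>R h x) \<in> borel_measurable M"
      using that(1,2) by measurable
    show "AE x in M. norm (\<phi> x *\<^sub>R h x) \<le> norm (h x)"
      using that(3) by (simp add: mult_left_le_one_le)
  qed
  have "integrable M (\<lambda>x. g x \<bullet>\<^sub>o e)"
    by (rule integrable_bounded_linear[OF oct.bounded_linear_left g])
  then show ?thesis
    unfolding oct_mult_oct_exp using g \<alpha>
    by (intro Bochner_Integration.integrable_add bounded_scaleR)
      simp_all
qed

lemma integrable_OFT_integrand:
  fixes u :: "real^3 \<Rightarrow> octonion" and f :: "real^3"
  assumes "integrable lebesgue u"
  shows "integrable lebesgue (\<lambda>x. u x \<bullet>\<^sub>o oct_exp oct_e1 (- (2 * pi * f$1 * x$1))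
                    \<bullet>\<^sub>o oct_exp oct_e2 (- (2 * pi * f$2 * x$2))
                    \<bullet>\<^sub>o oct_exp oct_e4 (- (2 * pi * f$3 * x$3)))"
proof -
  have "(\<lambda>x::real^3. - (2 * pi * f$k * x$k)) \<in> borel_measurable lebesgue" for k
    by (intro measurable_completion) (auto intro!: borel_measurable_continuous_onI continuous_intros)
  then show ?thesis
    using assms by (intro integrable_oct_mult_oct_exp)
qed

lemma OFT_mean:
  fixes f g h :: "real^3"
  assumes u: "integrable lebesgue u"
    and mean: "\<And>x. v x \<bullet>\<^sub>o oct_exp oct_e1 (- (2 * pi * h$1 * x$1))
                    \<bullet>\<^sub>o oct_exp oct_e2 (- (2 * pi * h$2 * x$2))
                    \<bullet>\<^sub>o oct_exp oct_e4 (- (2 * pi * h$3 * x$3))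
      = (1/2) *\<^sub>R (u x \<bullet>\<^sub>o oct_exp oct_e1 (- (2 * pi * f$1 * x$1))
                    \<bullet>\<^sub>o oct_exp oct_e2 (- (2 * pi * f$2 * x$2))
                    \<bullet>\<^sub>o oct_exp oct_e4 (- (2 * pi * f$3 * x$3))
                + u x \<bullet>\<^sub>o oct_exp oct_e1 (- (2 * pi * g$1 * x$1))
                    \<bullet>\<^sub>o oct_exp oct_e2 (- (2 * pi * g$2 * x$2))
                    \<bullet>\<^sub>o oct_exp oct_e4 (- (2 * pi * g$3 * x$3)))"
  shows "OFT v h = (1/2) *\<^sub>R (OFT u f + OFT u g)"
  unfolding OFT_def mean
  by (simp add: Bochner_Integration.integral_add integrable_OFT_integrand[OF u])

text \<open>
  The signs in \<open>oct_exp_modulation\<close> are swapped here: the exponent is the negated phase, so adding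
  \<open>f0\<close> to the frequency subtracts the phase of the cosine from it.
\<close>

lemma oct_exp_frequency_shift:
  "cos (2 * pi * f0 * t) *\<^sub>R oct_exp e (- (2 * pi * f * t))
    = (1/2) *\<^sub>R (oct_exp e (- (2 * pi * (f + f0) * t)) + oct_exp e (- (2 * pi * (f - f0) * t)))"
  using oct_exp_modulation[of "2 * pi * f0 * t" e "- (2 * pi * f * t)"]
  by (simp add: algebra_simps)

theorem theorem10:
  fixes u :: "real^3 \<Rightarrow> octonion" and f0 :: real
  assumes "integrable lebesgue u"
  shows "\<forall>f1 f2 f3.
      OFT (\<lambda>x. cos (2 * pi * f0 * x$1) *\<^sub>R u x) (vector [f1, f2, f3]) =
        (1/2) *\<^sub>R (OFT u (vector [f1 + f0, f2, f3]) + OFT u (vector [f1 - f0, f2, f3])) \<and>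
      OFT (\<lambda>x. cos (2 * pi * f0 * x$2) *\<^sub>R u x) (vector [f1, f2, f3]) =
        (1/2) *\<^sub>R (OFT u (vector [f1, f2 + f0, f3]) + OFT u (vector [f1, f2 - f0, f3])) \<and>
      OFT (\<lambda>x. cos (2 * pi * f0 * x$3) *\<^sub>R u x) (vector [f1, f2, f3]) =
        (1/2) *\<^sub>R (OFT u (vector [f1, f2, f3 + f0]) + OFT u (vector [f1, f2, f3 - f0]))"
proof (intro allI conjI; rule OFT_mean[OF assms]; unfold vector_3)
  fix f1 f2 f3 :: real and x :: "real^3"
  let ?c = "\<lambda>t. cos (2 * pi * f0 * t)"
  let ?E = "\<lambda>e f t. oct_exp e (- (2 * pi * f * t))"
  \<comment> \<open>Bilinearity moves the cosine onto the exponential in the same coordinate, which is then split.\<close>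
  have "?c (x$1) *\<^sub>R u x \<bullet>\<^sub>o ?E oct_e1 f1 (x$1) \<bullet>\<^sub>o ?E oct_e2 f2 (x$2) \<bullet>\<^sub>o ?E oct_e4 f3 (x$3)
      = u x \<bullet>\<^sub>o (?c (x$1) *\<^sub>R ?E oct_e1 f1 (x$1)) \<bullet>\<^sub>o ?E oct_e2 f2 (x$2) \<bullet>\<^sub>o ?E oct_e4 f3 (x$3)"
    by (simp only: oct.scaleR_left oct.scaleR_right)
  then show "?c (x$1) *\<^sub>R u x \<bullet>\<^sub>o ?E oct_e1 f1 (x$1) \<bullet>\<^sub>o ?E oct_e2 f2 (x$2) \<bullet>\<^sub>o ?E oct_e4 f3 (x$3)
      = (1/2) *\<^sub>R (u x \<bullet>\<^sub>o ?E oct_e1 (f1 + f0) (x$1) \<bullet>\<^sub>o ?E oct_e2 f2 (x$2) \<bullet>\<^sub>o ?E oct_e4 f3 (x$3)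
                + u x \<bullet>\<^sub>o ?E oct_e1 (f1 - f0) (x$1) \<bullet>\<^sub>o ?E oct_e2 f2 (x$2) \<bullet>\<^sub>o ?E oct_e4 f3 (x$3))"
    unfolding oct_exp_frequency_shift
    by (simp only: oct.scaleR_left oct.scaleR_right oct.add_left oct.add_right)
  have "?c (x$2) *\<^sub>R u x \<bullet>\<^sub>o ?E oct_e1 f1 (x$1) \<bullet>\<^sub>o ?E oct_e2 f2 (x$2) \<bullet>\<^sub>o ?E oct_e4 f3 (x$3)
      = u x \<bullet>\<^sub>o ?E oct_e1 f1 (x$1) \<bullet>\<^sub>o (?c (x$2) *\<^sub>R ?E oct_e2 f2 (x$2)) \<bullet>\<^sub>o ?E oct_e4 f3 (x$3)"
    by (simp only: oct.scaleR_left oct.scaleR_right)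
  then show "?c (x$2) *\<^sub>R u x \<bullet>\<^sub>o ?E oct_e1 f1 (x$1) \<bullet>\<^sub>o ?E oct_e2 f2 (x$2) \<bullet>\<^sub>o ?E oct_e4 f3 (x$3)
      = (1/2) *\<^sub>R (u x \<bullet>\<^sub>o ?E oct_e1 f1 (x$1) \<bullet>\<^sub>o ?E oct_e2 (f2 + f0) (x$2) \<bullet>\<^sub>o ?E oct_e4 f3 (x$3)
                + u x \<bullet>\<^sub>o ?E oct_e1 f1 (x$1) \<bullet>\<^sub>o ?E oct_e2 (f2 - f0) (x$2) \<bullet>\<^sub>o ?E oct_e4 f3 (x$3))"
    unfolding oct_exp_frequency_shift
    by (simp only: oct.scaleR_left oct.scaleR_right oct.add_left oct.add_right)
  have "?c (x$3) *\<^sub>R u x \<bullet>\<^sub>o ?E oct_e1 f1 (x$1) \<bullet>\<^sub>o ?E oct_e2 f2 (x$2) \<bullet>\<^sub>o ?E oct_e4 f3 (x$3)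
      = u x \<bullet>\<^sub>o ?E oct_e1 f1 (x$1) \<bullet>\<^sub>o ?E oct_e2 f2 (x$2) \<bullet>\<^sub>o (?c (x$3) *\<^sub>R ?E oct_e4 f3 (x$3))"
    by (simp only: oct.scaleR_left oct.scaleR_right)
  then show "?c (x$3) *\<^sub>R u x \<bullet>\<^sub>o ?E oct_e1 f1 (x$1) \<bullet>\<^sub>o ?E oct_e2 f2 (x$2) \<bullet>\<^sub>o ?E oct_e4 f3 (x$3)
      = (1/2) *\<^sub>R (u x \<bullet>\<^sub>o ?E oct_e1 f1 (x$1) \<bullet>\<^sub>o ?E oct_e2 f2 (x$2) \<bullet>\<^sub>o ?E oct_e4 (f3 + f0) (x$3)
                + u x \<bullet>\<^sub>o ?E oct_e1 f1 (x$1) \<bullet>\<^sub>o ?E oct_e2 f2 (x$2) \<bullet>\<^sub>o ?E oct_e4 (f3 - f0) (x$3))"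
    unfolding oct_exp_frequency_shift
    by (simp only: oct.scaleR_left oct.scaleR_right oct.add_left oct.add_right)
qed

end
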